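(* Let $P\subset\mathbb{R}^d$ be a $d$-dimensional convex polytope containing the origin in its interior, and let $U$ be an orthogonal transformation of $\mathbb{R}^d$. Then $P=UP^\circ$ if and only if both of the following hold: (1) for all vertices $v,w$ of $P$, $\langle Uv,w\rangle\le 1$; (2) for each facet $F$ of $P$ there is a vertex $v$ of $P$ such that $\langle Uv,w\rangle=1$ for every vertex $w$ of $F$.
   Context: For $A\subseteq\mathbb{R}^d$, the polar is $A^\circ=\{x\in\mathbb{R}^d:\langle x,a\rangle\le 1\text{ for all }a\in A\}$. An orthogonal transformation is a linear map $U$ with $U^T=U^{-1}$; $UA=\{Ua:a\in A\}$. *)

theory Defs
  imports "HOL-Analysis.Analysis"
begin

definition polar :: "'a::real_inner set \<Rightarrow> 'a set"
  where "polar A = {x. \<forall>a\<in>A. x \<bullet> a \<le> 1}"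

end

theory Submission
  imports Defs
begin

text \<open>
  Since \<open>U\<close> is orthogonal, \<open>U P\<degree> = (U P)\<degree>\<close>. Condition (1) says
  \<open>P \<subseteq> (U P)\<degree>\<close>. If (2) holds and \<open>x \<in> (U P)\<degree>\<close> lay outside
  \<open>P\<close>, the segment from the origin to \<open>x\<close> would leave \<open>P\<close> through a point of some facet,
  where \<open>\<langle>U v, _\<rangle> = 1\<close>, so \<open>\<langle>U v, x\<rangle> > 1\<close>. Conversely, if \<open>P = (U P)\<degree>\<close>, then the
  bipolar theorem gives \<open>P\<degree> = U P\<close>, so the normal of a facet, scaled so that the facet lies at
  height 1, is \<open>U v\<close> for some \<open>v \<in> P\<close>; this \<open>v\<close> is a vertex because the facet
  determines its scaled normal.
\<close>

text \<open>The bipolar theorem: a point outside \<open>A\<close> is strictly separated from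
  \<open>A\<close>, and the separating functional, suitably rescaled, is an element of
  \<open>polar A\<close> that excludes the point.\<close>

lemma polar_polar:
  fixes A :: "'a::euclidean_space set"
  assumes "closed A" "convex A" "0 \<in> A"
  shows "polar (polar A) = A"
proof
  show "A \<subseteq> polar (polar A)"
    by (auto simp: polar_def inner_commute)
next
  show "polar (polar A) \<subseteq> A"
  proof (rule subsetI, rule ccontr)
    fix x assume x: "x \<in> polar (polar A)" and "x \<notin> A"
    then obtain a b where ab: "a \<bullet> x < b" "\<forall>y\<in>A. a \<bullet> y > b"
      using separating_hyperplane_closed_point[OF assms(2,1)] by blast
    then have b: "b < 0"
      using assms(3) by force
    \<comment> \<open>Dividing by the negative level \<open>b\<close> reverses both strict
      inequalities: the new functional is below 1 on \<open>A\<close> and above 1 at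
      \<open>x\<close>.\<close>
    have "(1 / b) *\<^sub>R a \<in> polar A"
      using ab(2) b by (auto simp: polar_def divide_simps less_imp_le)
    then have "x \<bullet> ((1 / b) *\<^sub>R a) \<le> 1"
      using x unfolding polar_def by blast
    then show False
      using ab(1) b by (simp add: divide_simps inner_commute)
  qed
qed

lemma orthogonal_transformation_image_polar:
  fixes U :: "'a::euclidean_space \<Rightarrow> 'a"
  assumes "orthogonal_transformation U"
  shows "U ` polar A = polar (U ` A)"
proof -
  have inner: "U x \<bullet> U y = x \<bullet> y" for x y
    using assms by (simp add: orthogonal_transformation_def)
  have "y \<in> U ` polar A" if "y \<in> polar (U ` A)" for y
  proof -
    obtain x where "y = U x"
      using orthogonal_transformation_surj[OF assms] by blast
    with that show ?thesis
      by (auto simp: polar_def inner)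
  qed
  then show ?thesis
    by (auto simp: polar_def inner)
qed

lemma hyperplane_normal_unique:
  fixes a b :: "'a::real_inner"
  assumes "{x. a \<bullet> x = 1} \<subseteq> {x. b \<bullet> x = 1}" "a \<noteq> 0"
  shows "b = a"
proof -
  define p where "p = (1 / (a \<bullet> a)) *\<^sub>R a"
  have ap: "a \<bullet> p = 1"
    using assms(2) by (simp add: p_def)
  then have bp: "b \<bullet> p = 1"
    using assms(1) by blast
  then have ba: "b \<bullet> a = a \<bullet> a"
    using assms(2) by (simp add: p_def field_simps)
  \<comment> \<open>Since \<open>b - a\<close> is orthogonal to \<open>a\<close>, moving from
    \<open>p\<close> along it stays in the hyperplane. Hence \<open>b\<close> is orthogonal to
    \<open>b - a\<close> too, which forces \<open>b - a\<close> to vanish.\<close>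
  have "a \<bullet> (p + (b - a)) = 1"
    using ap ba by (simp add: inner_add_right inner_diff_right inner_commute)
  then have "b \<bullet> (p + (b - a)) = 1"
    using assms(1) by blast
  then have "b \<bullet> (b - a) = 0"
    using bp by (simp add: inner_add_right)
  then have "(b - a) \<bullet> (b - a) = 0"
    using ba by (simp add: inner_diff_left inner_diff_right inner_commute)
  then show ?thesis
    by simp
qed

text \<open>The interior origin lies strictly inside the supporting halfspace of \<open>F\<close>,
  so its level is positive and can be scaled to 1. Uniqueness holds because a facet of a
  full-dimensional polyhedron affinely spans its supporting hyperplane.\<close>

lemma facet_scaled_normal:
  fixes P :: "'a::euclidean_space set"
  assumes "polyhedron P" "0 \<in> interior P" "F facet_of P"
  obtains n where "n \<in> polar P" "\<And>w. w \<in> F \<Longrightarrow> n \<bullet> w = 1"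
    "\<And>m. (\<And>w. w \<in> F \<Longrightarrow> m \<bullet> w = 1) \<Longrightarrow> m = n"
proof -
  have "interior P \<noteq> {}" using assms(2) by auto
  then have dim: "aff_dim P = int DIM('a)"
    by (rule aff_dim_nonempty_interior)
  have dimF: "aff_dim F = aff_dim P - 1" and "F \<noteq> {}"
    using assms(3) by (auto simp: facet_of_def)
  obtain a b where ab: "a \<noteq> 0" "P \<subseteq> {x. a \<bullet> x \<le> b}" "F = P \<inter> {x. a \<bullet> x = b}"
    using facet_of_polyhedron[OF assms(1,3)] by blast
  have "interior P \<subseteq> interior {x. a \<bullet> x \<le> b}"
    using ab(2) by (rule interior_mono)
  then have b: "b > 0"
    using assms(2) ab(1) by auto
  define n where "n = (1 / b) *\<^sub>R a"
  have n0: "n \<noteq> 0"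
    using ab(1) b by (simp add: n_def)
  have nF: "F \<subseteq> {x. n \<bullet> x = 1}"
    using ab(3) b by (auto simp: n_def)
  have "n \<in> polar P"
    using ab(2) b by (auto simp: polar_def n_def divide_simps)
  moreover have "m = n" if m: "\<And>w. w \<in> F \<Longrightarrow> m \<bullet> w = 1" for m
  proof (rule hyperplane_normal_unique[OF _ n0])
    have "affine hull F = affine hull {x. n \<bullet> x = 1}"
    proof (rule affine_dim_equal)
      show "affine hull F \<subseteq> affine hull {x. n \<bullet> x = 1}"
        using nF by (rule hull_mono)
      show "aff_dim (affine hull F) = aff_dim (affine hull {x. n \<bullet> x = 1})"
        using dimF dim n0 by (simp add: aff_dim_affine_hull)
    qed (use \<open>F \<noteq> {}\<close> in auto)
    then have "affine hull F = {x. n \<bullet> x = 1}"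
      by (simp add: hull_same affine_hyperplane)
    moreover have "affine hull F \<subseteq> {x. m \<bullet> x = 1}"
      using m by (intro hull_minimal) (auto simp: affine_hyperplane)
    ultimately show "{x. n \<bullet> x = 1} \<subseteq> {x. m \<bullet> x = 1}"
      by simp
  qed
  ultimately show ?thesis
    using that nF by blast
qed

text \<open>The segment from 0 to \<open>x\<close> is connected, so it crosses the frontier of
  \<open>P\<close>, and the relative boundary of a polyhedron is the union of its facets.\<close>

lemma segment_meets_facet:
  fixes P :: "'a::euclidean_space set"
  assumes "polyhedron P" "0 \<in> interior P" "x \<notin> P"
  obtains F t where "F facet_of P" "0 < t" "t < 1" "t *\<^sub>R x \<in> F"
proof -
  have "closed_segment 0 x \<inter> frontier P \<noteq> {}"
    using assms interior_subset[of P]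
    by (intro connected_Int_frontier) (auto simp: subset_iff)
  then obtain t where t: "0 \<le> t" "t \<le> 1" "t *\<^sub>R x \<in> frontier P"
    by (auto simp: closed_segment_def)
  have tP: "t *\<^sub>R x \<in> P"
    using t(3) polyhedron_imp_closed[OF assms(1)] frontier_subset_closed by blast
  have tI: "t *\<^sub>R x \<notin> interior P"
    using t(3) by (simp add: frontier_def)
  have "t \<noteq> 0" "t \<noteq> 1"
    using tI tP assms(2,3) by auto
  moreover have "rel_interior P = interior P"
    using assms(2) by (intro rel_interior_nonempty_interior) auto
  then have "t *\<^sub>R x \<in> P - rel_interior P"
    using tP tI by simp
  then obtain F where "F facet_of P" "t *\<^sub>R x \<in> F"
    using rel_boundary_of_polyhedron[OF assms(1)] by auto
  ultimately show ?thesis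
    using that t(1,2) by (simp add: order_le_less)
qed

text \<open>By Krein-Milman, this carries conditions stated only at vertices over to all points of a
  polytope.\<close>

lemma polytope_subset_if_extreme_points:
  fixes P :: "'a::euclidean_space set"
  assumes "polytope P" "convex C" "\<And>x. x extreme_point_of P \<Longrightarrow> x \<in> C"
  shows "P \<subseteq> C"
proof -
  have "P = convex hull {x. x extreme_point_of P}"
    using assms(1) by (intro Krein_Milman_Minkowski polytope_imp_compact polytope_imp_convex)
  also have "\<dots> \<subseteq> C"
    using assms(2,3) by (intro hull_minimal) auto
  finally show ?thesis .
qed

theorem theorem3p2:
  fixes P :: "(real ^ 'n) set" and U :: "real ^ 'n \<Rightarrow> real ^ 'n"
  assumes "polytope P"
    and "aff_dim P = int CARD('n)"
    and "0 \<in> interior P"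
    and "orthogonal_transformation U"
  shows "P = U ` polar P \<longleftrightarrow>
    (\<forall>v w. v extreme_point_of P \<longrightarrow> w extreme_point_of P \<longrightarrow> U v \<bullet> w \<le> 1) \<and>
    (\<forall>F. F facet_of P \<longrightarrow>
      (\<exists>v. v extreme_point_of P \<and> (\<forall>w. w extreme_point_of F \<longrightarrow> U v \<bullet> w = 1)))"
  (is "_ \<longleftrightarrow> ?vertices \<and> ?facets")
proof -
  have lin: "linear U"
    using assms(4) by (rule orthogonal_transformation_linear)
  have poly: "polyhedron P"
    using assms(1) by (rule polytope_imp_polyhedron)
  have UP: "polytope (U ` P)"
    using lin assms(1) by (rule polytope_linear_image)
  have zero: "0 \<in> U ` P"
    using assms(3) interior_subset[of P] linear_0[OF lin] by force
  have image: "U ` polar P = polar (U ` P)"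
    using assms(4) by (rule orthogonal_transformation_image_polar)
  show ?thesis
  proof
    assume eq: "P = U ` polar P"
    then have "polar P = polar (polar (U ` P))"
      using image by simp
    also have "\<dots> = U ` P"
      using UP zero by (intro polar_polar polytope_imp_closed polytope_imp_convex)
    finally have polar: "polar P = U ` P" .
    have le: "U v \<bullet> w \<le> 1" if "v \<in> P" "w \<in> P" for v w
    proof -
      have "U v \<in> polar P"
        using that(1) polar by simp
      then show ?thesis
        using that(2) by (simp add: polar_def)
    qed
    have ?facets
    proof (intro allI impI)
      fix F assume F: "F facet_of P"
      then obtain n where n: "n \<in> polar P" "\<And>w. w \<in> F \<Longrightarrow> n \<bullet> w = 1"
        "\<And>m. (\<And>w. w \<in> F \<Longrightarrow> m \<bullet> w = 1) \<Longrightarrow> m = n"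
        using facet_scaled_normal[OF poly assms(3)] by metis
      obtain v where v: "v \<in> P" "n = U v"
        using n(1) polar by auto
      have "\<not> v \<in> open_segment a b" if ab: "a \<in> P" "b \<in> P" for a b
      proof
        assume "v \<in> open_segment a b"
        then obtain u where u: "a \<noteq> b" "0 < u" "u < 1" "v = (1 - u) *\<^sub>R a + u *\<^sub>R b"
          by (auto simp: in_segment)
        \<comment> \<open>A proper weighted average of two numbers at most 1 equals 1 only if both
          do. So \<open>U a\<close> and \<open>U b\<close> are both the scaled normal of
          \<open>F\<close>, and injectivity of \<open>U\<close> gives \<open>a = b\<close>.\<close>
        have "U a \<bullet> w = 1 \<and> U b \<bullet> w = 1" if w: "w \<in> F" for w
        proof -
          have "w \<in> P"
            using F w facet_of_imp_subset by blast
          then have "U a \<bullet> w \<le> 1" "U b \<bullet> w \<le> 1"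
            using ab le by auto
          then have le': "(1 - u) * (U a \<bullet> w) \<le> 1 - u" "u * (U b \<bullet> w) \<le> u"
            using u(2,3) by (simp_all add: mult_left_le)
          have "(1 - u) * (U a \<bullet> w) + u * (U b \<bullet> w) = 1"
            using n(2)[OF w] v(2) u(4)
            by (simp add: linear_add[OF lin] linear_scale[OF lin] inner_add_left)
          then have "(1 - u) * (U a \<bullet> w) = 1 - u" "u * (U b \<bullet> w) = u"
            using le' by linarith+
          then show ?thesis
            using u(2,3) by simp
        qed
        then have "U a = U b"
          using n(3)[of "U a"] n(3)[of "U b"] by simp
        then show False
          using u(1) orthogonal_transformation_inj[OF assms(4)] by (simp add: inj_eq)
      qed
      then have "v extreme_point_of P"
        using v(1) by (auto simp: extreme_point_of_def)
      moreover have "U v \<bullet> w = 1" if "w extreme_point_of F" for w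
        using n(2) v(2) that by (auto simp: extreme_point_of_def)
      ultimately show "\<exists>v. v extreme_point_of P \<and> (\<forall>w. w extreme_point_of F \<longrightarrow> U v \<bullet> w = 1)"
        by blast
    qed
    moreover have ?vertices
      using le by (simp add: extreme_point_of_def)
    ultimately show "?vertices \<and> ?facets"
      by blast
  next
    assume rhs: "?vertices \<and> ?facets"
    \<comment> \<open>Condition (1) is extended from vertices to \<open>P\<close> one argument at a
      time: first in \<open>v\<close> with the vertex \<open>w\<close> fixed, then in
      \<open>w\<close>.\<close>
    have "w \<in> polar (U ` P)" if w: "w extreme_point_of P" for w
    proof -
      have "convex {v. U v \<bullet> w \<le> 1}"
        using convex_linear_vimage[OF lin convex_halfspace_le[of w 1]]
        by (simp add: vimage_def inner_commute)
      then have "P \<subseteq> {v. U v \<bullet> w \<le> 1}"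
        using rhs w by (intro polytope_subset_if_extreme_points[OF assms(1)]) auto
      then show ?thesis
        by (auto simp: polar_def inner_commute)
    qed
    moreover have "convex (polar (U ` P))"
    proof -
      have "polar (U ` P) = (\<Inter>a\<in>U ` P. {x. a \<bullet> x \<le> 1})"
        by (auto simp: polar_def inner_commute)
      then show ?thesis
        by (auto intro!: convex_INT convex_halfspace_le)
    qed
    ultimately have "P \<subseteq> polar (U ` P)"
      by (intro polytope_subset_if_extreme_points[OF assms(1)])
    moreover have "x \<in> P" if x: "x \<in> polar (U ` P)" for x
    proof (rule ccontr)
      assume "x \<notin> P"
      then obtain F t where F: "F facet_of P" and t: "0 < t" "t < 1" "t *\<^sub>R x \<in> F"
        using segment_meets_facet[OF poly assms(3)] by blast
      obtain v where v: "v extreme_point_of P" "\<And>w. w extreme_point_of F \<Longrightarrow> U v \<bullet> w = 1"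
        using rhs F by blast
      have "polytope F"
        using F assms(1) face_of_polytope_polytope facet_of_imp_face_of by blast
      then have "F \<subseteq> {w. U v \<bullet> w = 1}"
        using v(2) by (intro polytope_subset_if_extreme_points) (auto simp: convex_hyperplane)
      then have one: "t * (U v \<bullet> x) = 1"
        using t(3) by auto
      \<comment> \<open>This bound contradicts \<open>one\<close>, as scaling by
        \<open>t < 1\<close> cannot bring a number at most 1 up to 1.\<close>
      have "U v \<bullet> x \<le> 1"
        using x v(1) by (auto simp: polar_def extreme_point_of_def inner_commute)
      then have "t * (U v \<bullet> x) \<le> t"
        using t(1) by (simp add: mult_left_le)
      then show False
        using one t(2) by simp
    qed
    ultimately show "P = U ` polar P"
      using image by blast
  qed
qed

end
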